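(* For every integer $k \geq 3$, $\mathcal{G}(\mathcal{P}_{0,1}(2k,1))=0$.
   Context: Toggle: Let $G$ be a finite simple graph, with $N[v]$ the closed neighborhood of $v$. A position $\{G,V_0\}$ consists of $G$ and a set $V_0\subseteq V(G)$ of vertices of weight $0$; all other vertices have weight $1$. Let $\sigma(v)$ be the sum of the weights of the vertices in $N[v]$. A legal move consists of choosing a vertex $v$ of weight $1$ and switching the weight ($0\leftrightarrow 1$) of every vertex of $N[v]$; it is allowed only if $\sigma(v)$ after the switch is strictly smaller than $\sigma(v)$ before it. Two players alternate legal moves; a player with no legal move loses. Nimbers: $\mathcal{G}(\mathcal{S})=\mathrm{mex}\{\mathcal{G}(\mathcal{S}') : \mathcal{S}' \text{ reachable from } \mathcal{S} \text{ by one legal move}\}$, where $\mathrm{mex}(T)$ is the least nonnegative integer not in the finite set $T$ (so $\mathrm{mex}(\emptyset)=0$). The generalized Petersen graph $P(m,1)$ ($m\ge 3$) has inner vertices $v_{0,1},\dots,v_{0,m}$ and outer vertices $v_{1,1},\dots,v_{1,m}$ (second indices modulo $m$), with edges $v_{1,i}v_{1,i+1}$, $v_{0,i}v_{0,i+1}$ and $v_{0,i}v_{1,i}$ for all $i$. $\mathcal{P}_{0,1}(m,1)$ is the position on $P(m,1)$ in which all inner vertices have weight $0$ and all outer vertices have weight $1$. *)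

theory Defs
  imports "Graph_Theory.Pair_Digraph"
begin

text \<open>
  A finite simple graph is a \<^locale>\<open>pair_graph\<close>: finite, loop-free and symmetric, each edge
  being represented by its two arcs. A position on the graph \<open>G\<close> is given by the set \<open>V0\<close> of
  the vertices of weight 0.
\<close>

definition closed_nbhd :: "'a pair_pre_digraph \<Rightarrow> 'a \<Rightarrow> 'a set" where
  "closed_nbhd G v = insert v {u. (v, u) \<in> parcs G}"

definition weight :: "'a set \<Rightarrow> 'a \<Rightarrow> nat" where
  "weight V0 v = (if v \<in> V0 then 0 else 1)"

definition nbhd_weight :: "'a pair_pre_digraph \<Rightarrow> 'a set \<Rightarrow> 'a \<Rightarrow> nat" where
  "nbhd_weight G V0 v = (\<Sum>u\<in>closed_nbhd G v. weight V0 u)"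

text \<open>Switching the weights on \<open>N[v]\<close> replaces \<open>V0\<close> by its symmetric difference with \<open>N[v]\<close>.\<close>

definition switch :: "'a pair_pre_digraph \<Rightarrow> 'a set \<Rightarrow> 'a \<Rightarrow> 'a set" where
  "switch G V0 v = (V0 - closed_nbhd G v) \<union> (closed_nbhd G v - V0)"

definition legal_move :: "'a pair_pre_digraph \<Rightarrow> 'a set \<Rightarrow> 'a \<Rightarrow> bool" where
  "legal_move G V0 v \<longleftrightarrow>
     v \<in> pverts G \<and> weight V0 v = 1 \<and> nbhd_weight G (switch G V0 v) v < nbhd_weight G V0 v"

definition options :: "'a pair_pre_digraph \<Rightarrow> 'a set \<Rightarrow> 'a set set" where
  "options G V0 = {switch G V0 v | v. legal_move G V0 v}"

definition mex :: "nat set \<Rightarrow> nat" where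
  "mex T = (LEAST n. n \<notin> T)"

context pair_graph
begin

lemma closed_nbhd_subset: "v \<in> pverts G \<Longrightarrow> closed_nbhd G v \<subseteq> pverts G"
  by (auto simp: closed_nbhd_def dest: in_arcsD2)

lemma nbhd_weight_eq_card:
  assumes "v \<in> pverts G"
  shows "nbhd_weight G V0 v = card (closed_nbhd G v - V0)"
proof -
  have fin: "finite (closed_nbhd G v)"
    using closed_nbhd_subset[OF assms] pair_finite_verts finite_subset by blast
  have "nbhd_weight G V0 v = (\<Sum>u\<in>closed_nbhd G v. if u \<notin> V0 then 1 else 0)"
    unfolding nbhd_weight_def weight_def by (intro sum.cong) auto
  also have "\<dots> = (\<Sum>u\<in>{u \<in> closed_nbhd G v. u \<notin> V0}. 1)"
    using fin by (simp only: sum.inter_filter)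
  also have "\<dots> = card (closed_nbhd G v - V0)"
    by (simp add: set_diff_eq)
  finally show ?thesis .
qed

lemma card_option_less:
  assumes "W \<in> options G V0"
  shows "card (pverts G - W) < card (pverts G - V0)"
proof -
  obtain v where W: "W = switch G V0 v" and v: "v \<in> pverts G"
    and less: "nbhd_weight G W v < nbhd_weight G V0 v"
    using assms by (auto simp: options_def legal_move_def)
  let ?N = "closed_nbhd G v"
  have sub: "?N \<subseteq> pverts G" by (rule closed_nbhd_subset[OF v])
  have split: "card (pverts G - X) = card (pverts G - ?N - X) + card (?N - X)" for X
  proof -
    have "pverts G - X = (pverts G - ?N - X) \<union> (?N - X)" using sub by auto
    moreover have "finite (pverts G - ?N - X)" "finite (?N - X)"
      using pair_finite_verts sub finite_subset by blast+
    ultimately show ?thesis by (metis (no_types, lifting) card_Un_disjoint Diff_disjoint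
      Diff_Int_distrib Diff_Int2 Diff_empty Diff_Diff_Int inf_commute Int_Diff)
  qed
  have "pverts G - ?N - W = pverts G - ?N - V0"
    by (auto simp: W switch_def)
  then show ?thesis
    using less by (simp add: split[of W] split[of V0] nbhd_weight_eq_card[OF v])
qed

text \<open>
  The recursion is well-founded because the number of vertices of weight 1 drops with each move.
\<close>

function nimber :: "'a set \<Rightarrow> nat" where
  "nimber V0 = mex (nimber ` options G V0)"
  by auto
termination
  by (relation "measure (\<lambda>V0. card (pverts G - V0))") (auto simp: card_option_less)

declare nimber.simps [simp del]

end

text \<open>
  The generalized Petersen graph \<open>P(m,1)\<close>: the vertex \<open>(0, i)\<close> is the inner vertex \<open>v\<^sub>0\<^sub>,\<^sub>i\<close> and
  \<open>(1, i)\<close> the outer vertex \<open>v\<^sub>1\<^sub>,\<^sub>i\<close>; the residues modulo \<open>m\<close> are represented by \<open>0, \<dots>, m - 1\<close>.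
\<close>

definition petersen_edges :: "nat \<Rightarrow> ((nat \<times> nat) \<times> (nat \<times> nat)) set" where
  "petersen_edges m =
     {((1, i), (1, (i + 1) mod m)) | i. i < m} \<union>
     {((0, i), (0, (i + 1) mod m)) | i. i < m} \<union>
     {((0, i), (1, i)) | i. i < m}"

definition petersen :: "nat \<Rightarrow> (nat \<times> nat) pair_pre_digraph" where
  "petersen m =
     \<lparr> pverts = {0, 1} \<times> {0..<m}, parcs = petersen_edges m \<union> (petersen_edges m)\<inverse> \<rparr>"

lemma pair_graph_petersen:
  assumes "m \<ge> 3"
  shows "pair_graph (petersen m)"
proof -
  have mod: "(i + 1) mod m \<noteq> i" "(i + 1) mod m < m" if "i < m" for i
    using that assms by (cases "i + 1 = m"; simp)+
  have sub: "parcs (petersen m) \<subseteq> pverts (petersen m) \<times> pverts (petersen m)"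
    using mod by (auto simp: petersen_def petersen_edges_def)
  have fin: "finite (pverts (petersen m))"
    by (simp add: petersen_def)
  show ?thesis
  proof
    show "fst e \<in> pverts (petersen m)" "snd e \<in> pverts (petersen m)"
      if "e \<in> parcs (petersen m)" for e
      using that sub by auto
    show "finite (pverts (petersen m))" by (rule fin)
    show "finite (parcs (petersen m))"
      using sub fin by (meson finite_SigmaI finite_subset)
    show "fst e \<noteq> snd e" if "e \<in> parcs (petersen m)" for e
      using that mod by (force simp: petersen_def petersen_edges_def)
    show "symmetric (with_proj (petersen m))"
      by (auto simp: symmetric_def sym_def petersen_def)
  qed
qed

text \<open>The weight-0 set of the position \<open>\<P>\<^sub>0\<^sub>,\<^sub>1(m,1)\<close>: all inner vertices.\<close>

definition petersen01 :: "nat \<Rightarrow> (nat \<times> nat) set" where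
  "petersen01 m = {0} \<times> {0..<m}"

end

theory Submission
  imports Defs
begin

text \<open>
  The second player answers a move at \<open>v\<close> with a move at the antipodal vertex, obtained by
  rotating the prism by \<open>k\<close>. Since \<open>k \<ge> 3\<close>, the closed neighbourhoods of antipodal vertices are
  disjoint, so the answer is as legal as the move it mirrors and restores the symmetry.
\<close>

lemma mex_eq_0: "0 \<notin> T \<Longrightarrow> mex T = 0"
  by (simp add: mex_def)

lemma mex_notin:
  assumes "finite T"
  shows "mex T \<notin> T"
  unfolding mex_def using ex_new_if_finite[OF infinite_UNIV_nat assms] by (rule LeastI_ex)

context pair_graph
begin

text \<open>A mex vanishes exactly when 0 is missing from the set. The forward direction needs
  \<open>mex_notin\<close>, whose finiteness hypothesis holds because each option comes from one of
  finitely many vertices.\<close>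

lemma nimber_eq_0_iff: "nimber V0 = 0 \<longleftrightarrow> (\<forall>W \<in> options G V0. nimber W \<noteq> 0)"
proof -
  have "options G V0 \<subseteq> switch G V0 ` pverts G"
    by (auto simp: options_def legal_move_def)
  then have fin: "finite (nimber ` options G V0)"
    by (meson finite_imageI finite_subset pair_finite_verts)
  have "nimber V0 = mex (nimber ` options G V0)"
    by (rule nimber.simps)
  then have "nimber V0 = 0 \<longleftrightarrow> 0 \<notin> nimber ` options G V0"
    using mex_eq_0 mex_notin[OF fin] by metis
  then show ?thesis
    by (auto simp: image_iff)
qed

text \<open>The mirroring strategy for an arbitrary graph. Preservation of arcs in one direction is
  enough for an automorphism, since \<open>f\<close> is its own inverse on the vertices.\<close>

lemma nimber_eq_0_of_involution:
  assumes inv: "\<And>v. v \<in> pverts G \<Longrightarrow> f v \<in> pverts G \<and> f (f v) = v"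
    and arc: "\<And>u v. (u, v) \<in> parcs G \<Longrightarrow> (f u, f v) \<in> parcs G"
    and disj: "\<And>v. v \<in> pverts G \<Longrightarrow> closed_nbhd G v \<inter> closed_nbhd G (f v) = {}"
    and sym: "\<And>v. v \<in> pverts G \<Longrightarrow> f v \<in> V0 \<longleftrightarrow> v \<in> V0"
  shows "nimber V0 = 0"
  using sym
\<comment> \<open>One induction step covers a move together with its reply, so the symmetry of
  \<open>V0\<close> must be part of the statement being generalized.\<close>
proof (induction "card (pverts G - V0)" arbitrary: V0 rule: less_induct)
  case less
  note sym = less.prems
  have "nimber W \<noteq> 0" if W: "W \<in> options G V0" for W
  proof -
    obtain v where W_eq: "W = switch G V0 v" and legal: "legal_move G V0 v"
      using W by (auto simp: options_def)
    define N N' where "N = closed_nbhd G v" and "N' = closed_nbhd G (f v)"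
    define W' where "W' = switch G W (f v)"
    have v: "v \<in> pverts G" and fv: "f v \<in> pverts G"
      using legal inv by (auto simp: legal_move_def)
    have sub: "N \<subseteq> pverts G" "N' \<subseteq> pverts G"
      using closed_nbhd_subset v fv by (auto simp: N_def N'_def)
    have image: "f u \<in> closed_nbhd G (f w)" if "u \<in> closed_nbhd G w" for u w
      using that arc by (auto simp: closed_nbhd_def)
    \<comment> \<open>The converse implications apply \<open>image\<close> to \<open>f u\<close> and
      cancel \<open>f (f u)\<close>; this cancellation is available only on vertices.\<close>
    have N'_iff: "f u \<in> N' \<longleftrightarrow> u \<in> N" and N_iff: "f u \<in> N \<longleftrightarrow> u \<in> N'" if "u \<in> pverts G" for u
      using image[of u v] image[of "f u" "f v"] image[of u "f v"] image[of "f u" v] inv that v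
      by (auto simp: N_def N'_def)
    have N'_eq: "N' = f ` N"
    proof
      show "N' \<subseteq> f ` N"
      proof
        fix u assume "u \<in> N'"
        then have "f u \<in> N" "u = f (f u)" using N_iff sub inv by auto
        then show "u \<in> f ` N" by blast
      qed
      show "f ` N \<subseteq> N'" using N'_iff sub by auto
    qed
    have inj: "inj_on f N"
      using inv sub by (metis inj_on_inverseI subsetD)
    have disj': "N \<inter> N' = {}"
      using disj[OF v] by (simp add: N_def N'_def)
    \<comment> \<open>By disjointness the two switches act as a single switch on the union of
      \<open>N\<close> and \<open>N'\<close>, a set that \<open>f\<close> preserves.\<close>
    have W'_iff: "u \<in> W' \<longleftrightarrow> (u \<in> V0) \<noteq> (u \<in> N \<or> u \<in> N')" for u
      using disj' by (auto simp: W'_def W_eq switch_def N_def[symmetric] N'_def[symmetric])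
    have "f v \<in> N'" by (simp add: N'_def closed_nbhd_def)
    \<comment> \<open>The first move does not reach \<open>f v\<close>, which therefore still has
      the weight that it shares with \<open>v\<close> in \<open>V0\<close>.\<close>
    then have fv_weight: "weight W (f v) = 1"
      using legal disj' sym[OF v]
      by (auto simp: legal_move_def weight_def W_eq switch_def N_def[symmetric] split: if_splits)
    have "N' - W = N' - V0" "N' - W' = N' \<inter> V0" "N - W = N \<inter> V0"
      using disj' by (auto simp: W'_iff W_eq switch_def N_def[symmetric])
    moreover have "f ` (N - V0) = N' - V0" "f ` (N \<inter> V0) = N' \<inter> V0"
      using sub sym unfolding N'_eq by blast+
    \<comment> \<open>The weight-1 vertices around \<open>f v\<close> before and after the reply are
      the images of those around \<open>v\<close> before and after the first move, so the strict
      drop carries over.\<close>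
    ultimately have "N' - W = f ` (N - V0)" "N' - W' = f ` (N - W)"
      by simp_all
    moreover have "card (f ` (N - X)) = card (N - X)" for X
      using inj by (meson Diff_subset card_image inj_on_subset)
    moreover have "card (N - W) < card (N - V0)"
      using legal by (simp add: legal_move_def W_eq nbhd_weight_eq_card[OF v] N_def)
    ultimately have "nbhd_weight G W' (f v) < nbhd_weight G W (f v)"
      by (simp add: nbhd_weight_eq_card[OF fv] N'_def[symmetric])
    then have W': "W' \<in> options G W"
      using fv fv_weight by (auto simp: options_def legal_move_def W'_def)
    have "nimber W' = 0"
    proof (rule less.hyps)
      show "card (pverts G - W') < card (pverts G - V0)"
        using card_option_less[OF W] card_option_less[OF W'] by simp
      show "f u \<in> W' \<longleftrightarrow> u \<in> W'" if "u \<in> pverts G" for u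
        using that N_iff N'_iff sym by (auto simp: W'_iff)
    qed
    then show ?thesis
      using W' nimber_eq_0_iff by blast
  qed
  then show ?case
    by (rule nimber_eq_0_iff[THEN iffD2, OF ballI])
qed

end

text \<open>For indices below \<open>2 * k\<close> this is addition of \<open>k\<close> modulo
  \<open>2 * k\<close>, written with a case split to stay within linear arithmetic.\<close>

definition antipode :: "nat \<Rightarrow> nat \<times> nat \<Rightarrow> nat \<times> nat" where
  "antipode k = (\<lambda>(a, i). (a, if i < k then i + k else i - k))"

text \<open>Replacing \<open>mod\<close> by an explicit wraparound leaves only linear conditions,
  which \<open>auto\<close> can settle after splitting. The two disjuncts are the two orientations
  of a rim edge.\<close>

lemma parcs_petersen_iff:
  "((a, i), (b, j)) \<in> parcs (petersen m) \<longleftrightarrow>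
     a \<le> 1 \<and> b \<le> 1 \<and> i < m \<and> j < m \<and>
     (if a = b then j = (if i + 1 = m then 0 else i + 1) \<or> i = (if j + 1 = m then 0 else j + 1)
      else i = j)"
proof -
  \<comment> \<open>Keeping the successor relation folded hides the wraparound case split from the
    final \<open>auto\<close>.\<close>
  define S where "S i j \<longleftrightarrow> j = (if i + 1 = m then 0 else i + 1)" for i j
  have succ: "i < m \<and> j = (i + 1) mod m \<longleftrightarrow> i < m \<and> j < m \<and> S i j" for i j
    by (cases "i + 1 = m") (auto simp: S_def)
  have "((a, i), (b, j)) \<in> petersen_edges m \<longleftrightarrow>
      (a = b \<and> (a = 0 \<or> a = 1) \<and> (i < m \<and> j = (i + 1) mod m)) \<or>
      (a = 0 \<and> b = 1 \<and> i = j \<and> i < m)" for a b i j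
    unfolding petersen_edges_def by blast
  note edge = this[unfolded succ]
  show ?thesis
    unfolding petersen_def pair_pre_digraph.simps Un_iff converse_iff edge S_def[symmetric]
    by (auto simp: le_Suc_eq)
qed

theorem theorem4p10:
  fixes k :: nat
  assumes "k \<ge> 3"
  shows "pair_graph.nimber (petersen (2 * k)) (petersen01 (2 * k)) = 0"
proof -
  interpret pair_graph "petersen (2 * k)"
    using assms by (intro pair_graph_petersen) simp
  show ?thesis
  proof (rule nimber_eq_0_of_involution[where f = "antipode k"])
    show "antipode k v \<in> pverts (petersen (2 * k)) \<and> antipode k (antipode k v) = v"
      if "v \<in> pverts (petersen (2 * k))" for v
      using that by (auto simp: petersen_def antipode_def)
    show "(antipode k u, antipode k v) \<in> parcs (petersen (2 * k))"
      if "(u, v) \<in> parcs (petersen (2 * k))" for u v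
    proof -
      obtain a i b j where "u = (a, i)" "v = (b, j)" by fastforce
      \<comment> \<open>The rotation exchanges the wraparound edge from \<open>2 * k - 1\<close> to
        0 with the edge from \<open>k - 1\<close> to \<open>k\<close>; the splits cover these
        cases.\<close>
      then show ?thesis
        using that assms by (auto simp: antipode_def parcs_petersen_iff split: if_splits)
    qed
    show "closed_nbhd (petersen (2 * k)) v \<inter> closed_nbhd (petersen (2 * k)) (antipode k v) = {}"
      if "v \<in> pverts (petersen (2 * k))" for v
    proof -
      obtain a i where v: "v = (a, i)" by fastforce
      \<comment> \<open>Indices in a closed neighbourhood lie within cyclic distance 1 of its
        centre, while the two centres are \<open>k\<close> apart and \<open>k\<close> exceeds
        2.\<close>
      have "(b, j) \<notin> closed_nbhd (petersen (2 * k)) (antipode k v)"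
        if "(b, j) \<in> closed_nbhd (petersen (2 * k)) v" for b j
        using that assms
        by (auto simp: v closed_nbhd_def antipode_def parcs_petersen_iff split: if_splits)
      then show ?thesis by auto
    qed
    show "antipode k v \<in> petersen01 (2 * k) \<longleftrightarrow> v \<in> petersen01 (2 * k)"
      if "v \<in> pverts (petersen (2 * k))" for v
      using that by (auto simp: petersen_def petersen01_def antipode_def)
  qed
qed

end
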